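(* There exist infinitely many (pairwise non-isomorphic) purely non-strongly real Beauville groups.
   Context: Conjugation convention: $g^h=hgh^{-1}$. For a finite group $G$ with identity $e$ and $x,y\in G$, let \[ \Sigma(x,y):=\bigcup_{i=1}^{|G|}\bigcup_{g\in G}\{(x^i)^g,(y^i)^g,((xy)^i)^g\}. \] A Beauville structure for a finite group $G$ is a set of pairs $\{(x_1,y_1),(x_2,y_2)\}\subset G\times G$ such that $\langle x_1,y_1\rangle=\langle x_2,y_2\rangle=G$ and $\Sigma(x_1,y_1)\cap\Sigma(x_2,y_2)=\{e\}$. A finite group $G$ is a Beauville group if it has a Beauville structure. A Beauville structure $\{(x_1,y_1),(x_2,y_2)\}$ of $G$ is strongly real if there exist an automorphism $\phi\in\mathrm{Aut}(G)$ and elements $g_1,g_2\in G$ such that $g_i\phi(x_i)g_i^{-1}=x_i^{-1}$ and $g_i\phi(y_i)g_i^{-1}=y_i^{-1}$ for $i=1,2$. A finite group $G$ is a purely non-strongly real Beauville group if $G$ is a Beauville group and none of its Beauville structures is strongly real. *)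

theory Defs
  imports "HOL-Algebra.Generated_Groups" "HOL-Algebra.Bij"
begin

text \<open>Conjugation follows the convention \<open>g\<^sup>h = h g h\<inverse>\<close>.\<close>

definition conjugate :: "('a, 'b) monoid_scheme \<Rightarrow> 'a \<Rightarrow> 'a \<Rightarrow> 'a" where
  "conjugate G g h = h \<otimes>\<^bsub>G\<^esub> g \<otimes>\<^bsub>G\<^esub> inv\<^bsub>G\<^esub> h"

definition Sigma_set :: "('a, 'b) monoid_scheme \<Rightarrow> 'a \<Rightarrow> 'a \<Rightarrow> 'a set" where
  "Sigma_set G x y =
     (\<Union>i\<in>{1..order G}. \<Union>g\<in>carrier G.
        {conjugate G (x [^]\<^bsub>G\<^esub> (i::nat)) g,
         conjugate G (y [^]\<^bsub>G\<^esub> i) g,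
         conjugate G ((x \<otimes>\<^bsub>G\<^esub> y) [^]\<^bsub>G\<^esub> i) g})"

definition beauville_structure :: "('a, 'b) monoid_scheme \<Rightarrow> ('a \<times> 'a) set \<Rightarrow> bool" where
  "beauville_structure G S \<longleftrightarrow>
     (\<exists>x1\<in>carrier G. \<exists>y1\<in>carrier G. \<exists>x2\<in>carrier G. \<exists>y2\<in>carrier G.
        S = {(x1, y1), (x2, y2)} \<and>
        generate G {x1, y1} = carrier G \<and>
        generate G {x2, y2} = carrier G \<and>
        Sigma_set G x1 y1 \<inter> Sigma_set G x2 y2 = {\<one>\<^bsub>G\<^esub>})"

definition beauville_group :: "('a, 'b) monoid_scheme \<Rightarrow> bool" where
  "beauville_group G \<longleftrightarrow>
     group G \<and> finite (carrier G) \<and> (\<exists>S. beauville_structure G S)"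

text \<open>One automorphism serves both pairs, while the conjugating element may depend on the pair.\<close>

definition strongly_real :: "('a, 'b) monoid_scheme \<Rightarrow> ('a \<times> 'a) set \<Rightarrow> bool" where
  "strongly_real G S \<longleftrightarrow>
     (\<exists>\<phi>\<in>auto G. \<forall>(x, y)\<in>S. \<exists>g\<in>carrier G.
        g \<otimes>\<^bsub>G\<^esub> \<phi> x \<otimes>\<^bsub>G\<^esub> inv\<^bsub>G\<^esub> g = inv\<^bsub>G\<^esub> x \<and>
        g \<otimes>\<^bsub>G\<^esub> \<phi> y \<otimes>\<^bsub>G\<^esub> inv\<^bsub>G\<^esub> g = inv\<^bsub>G\<^esub> y)"

definition purely_non_strongly_real_beauville_group :: "('a, 'b) monoid_scheme \<Rightarrow> bool" where
  "purely_non_strongly_real_beauville_group G \<longleftrightarrow>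
     beauville_group G \<and> (\<forall>S. beauville_structure G S \<longrightarrow> \<not> strongly_real G S)"

end

theory Submission
  imports Defs "HOL-Algebra.Multiplicative_Group" "HOL-Number_Theory.Cong" "HOL-Library.Nat_Bijection"
begin

text \<open>
  For \<open>n\<close> coprime to \<open>6\<close>, let \<open>G\<close> be the metacyclic group \<open>\<int>/n\<^sup>2 \<rtimes> \<int>/n\<^sup>2\<close> in which the generator
  \<open>b\<close> of the second factor acts on the generator \<open>a\<close> of the first by \<open>a \<mapsto> a\<^bsup>1+n\<^esup>\<close>.

  Modulo \<open>n\<close> the group becomes \<open>(\<int>/n)\<^sup>2\<close>, and the powers of two elements whose images there have
  unit determinant are conjugate only if trivial. Hence for a Beauville structure it
  suffices that the two triples \<open>x, y, xy\<close> have images with unit determinants across the triples: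
  \<open>(1,0), (0,1), (1,1)\<close> and \<open>(1,2), (1,-1), (2,1)\<close> will do.

  If an endomorphism \<open>\<psi>\<close> inverts a generating pair, it acts as \<open>-1\<close> on \<open>(\<int>/n)\<^sup>2\<close>. The commutator
  is a bilinear function of the images modulo \<open>n\<close>, so \<open>\<psi>\<close> fixes \<open>[b,a] = a\<^sup>n\<close>; but the \<open>n\<close>-th power
  map is linear in these images, so \<open>\<psi>\<close> inverts \<open>a\<^sup>n\<close>. As \<open>a\<^sup>n\<close> has odd order \<open>n > 1\<close>, this is absurd.
\<close>

text \<open>\<open>el n i j\<close> encodes \<open>a\<^sup>i b\<^sup>j\<close>, with both exponents reduced modulo \<open>n\<^sup>2\<close>.\<close>

definition el :: "int \<Rightarrow> int \<Rightarrow> int \<Rightarrow> nat" where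
  "el n i j = prod_encode (nat (i mod n^2), nat (j mod n^2))"

text \<open>Modulo \<open>n^2\<close> one has \<open>(1+n)^j = 1 + n*j\<close>, so moving
  \<open>b^j\<close> past \<open>a^k\<close> adds \<open>n*j*k\<close> to the exponent of
  \<open>a\<close>. Coding elements as naturals gives the groups for all \<open>n\<close> a common
  type.\<close>

definition metacyclic :: "int \<Rightarrow> nat monoid" where
  "metacyclic n =
     \<lparr>carrier = {el n i j |i j. True},
      monoid.mult = (\<lambda>u v. case prod_decode u of (i, j) \<Rightarrow> case prod_decode v of (k, l) \<Rightarrow>
        el n (int i + int k + n * int j * int k) (int j + int l)),
      one = el n 0 0\<rparr>"

context
  fixes n :: int
  assumes n_pos: "n > 0"
begin

section \<open>Normal forms and group axioms\<close>

lemma el_eq_iff: "el n i j = el n k l \<longleftrightarrow> [i = k] (mod n^2) \<and> [j = l] (mod n^2)"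
  using n_pos by (auto simp: el_def cong_def nat_eq_iff2)

lemma el_eqI: "n^2 dvd i - k \<Longrightarrow> n^2 dvd j - l \<Longrightarrow> el n i j = el n k l"
  by (simp add: el_eq_iff cong_iff_dvd_diff)

lemma el_eqD:
  assumes "el n i j = el n k l"
  shows "n^2 dvd i - k" "n^2 dvd j - l"
  using assms by (simp_all add: el_eq_iff cong_iff_dvd_diff)

lemma el_closed [simp]: "el n i j \<in> carrier (metacyclic n)"
  by (auto simp: metacyclic_def)

lemma el_cases:
  assumes "u \<in> carrier (metacyclic n)"
  obtains i j where "u = el n i j"
  using assms by (auto simp: metacyclic_def)

lemma one_metacyclic: "\<one>\<^bsub>metacyclic n\<^esub> = el n 0 0"
  by (simp add: metacyclic_def)

lemma mult_el [simp]: "el n i j \<otimes>\<^bsub>metacyclic n\<^esub> el n k l = el n (i + k + n * j * k) (j + l)"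
proof -
  have "el n i j \<otimes>\<^bsub>metacyclic n\<^esub> el n k l
      = el n (i mod n^2 + k mod n^2 + n * (j mod n^2) * (k mod n^2)) (j mod n^2 + l mod n^2)"
    using n_pos by (simp add: metacyclic_def el_def)
  also have "\<dots> = el n (i + k + n * j * k) (j + l)"
    unfolding el_eq_iff by (intro conjI cong_add cong_mult cong_refl cong_mod_leftI)
  finally show ?thesis .
qed

lemma group_metacyclic: "group (metacyclic n)"
proof (rule groupI)
  fix x y z
  assume "x \<in> carrier (metacyclic n)" "y \<in> carrier (metacyclic n)" "z \<in> carrier (metacyclic n)"
  then obtain i j k l p q where xyz: "x = el n i j" "y = el n k l" "z = el n p q"
    by (meson el_cases)
  show "x \<otimes>\<^bsub>metacyclic n\<^esub> y \<otimes>\<^bsub>metacyclic n\<^esub> z = x \<otimes>\<^bsub>metacyclic n\<^esub> (y \<otimes>\<^bsub>metacyclic n\<^esub> z)"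
    unfolding xyz mult_el
    \<comment> \<open>The exponents of \<open>a\<close> on the two sides differ by
      \<open>n^2*j*l*p\<close>.\<close>
    by (rule el_eqI) (auto simp: algebra_simps power2_eq_square)
next
  fix x y
  assume "x \<in> carrier (metacyclic n)" "y \<in> carrier (metacyclic n)"
  then show "x \<otimes>\<^bsub>metacyclic n\<^esub> y \<in> carrier (metacyclic n)"
    by (metis el_cases el_closed mult_el)
next
  show "\<one>\<^bsub>metacyclic n\<^esub> \<in> carrier (metacyclic n)"
    by (simp add: one_metacyclic)
next
  fix x assume "x \<in> carrier (metacyclic n)"
  then obtain i j where x: "x = el n i j"
    by (rule el_cases)
  show "\<one>\<^bsub>metacyclic n\<^esub> \<otimes>\<^bsub>metacyclic n\<^esub> x = x"
    by (simp add: x one_metacyclic)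
  \<comment> \<open>This is \<open>b^(-j) a^(-i)\<close> in normal form.\<close>
  have "el n (n * j * i - i) (- j) \<otimes>\<^bsub>metacyclic n\<^esub> x = \<one>\<^bsub>metacyclic n\<^esub>"
    by (simp add: x one_metacyclic)
  then show "\<exists>y\<in>carrier (metacyclic n). y \<otimes>\<^bsub>metacyclic n\<^esub> x = \<one>\<^bsub>metacyclic n\<^esub>"
    using el_closed by blast
qed

interpretation group "metacyclic n"
  by (rule group_metacyclic)

section \<open>Inverses, powers, conjugates and the order\<close>

lemma inv_el [simp]: "inv\<^bsub>metacyclic n\<^esub> (el n i j) = el n (n * j * i - i) (- j)"
  by (rule inv_equality) (simp_all add: one_metacyclic)

text \<open>For each of the \<open>t choose 2\<close> pairs of factors, the \<open>b^j\<close> of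
  the earlier one passes the \<open>a^i\<close> of the later one and contributes
  \<open>n*i*j\<close>.\<close>

lemma pow_el [simp]:
  "el n i j [^]\<^bsub>metacyclic n\<^esub> t = el n (int t * i + n * int (t choose 2) * i * j) (int t * j)"
proof (induction t)
  case 0
  then show ?case by (simp add: one_metacyclic numeral_2_eq_2)
next
  case (Suc t)
  have "Suc t choose 2 = t + (t choose 2)"
    by (simp add: numeral_2_eq_2)
  then show ?case
    by (simp add: Suc) (simp add: algebra_simps)
qed

text \<open>Conjugation only shifts the exponent of \<open>a\<close>, by \<open>n\<close> times the
  determinant of the two exponent pairs.\<close>

lemma conjugate_el:
  "conjugate (metacyclic n) (el n i j) (el n k l) = el n (i + n * (l * i - j * k)) j"
  unfolding conjugate_def inv_el mult_el
  by (rule el_eqI) (auto simp: algebra_simps power2_eq_square)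

text \<open>This value later separates the groups for different \<open>n\<close>; its positivity
  also yields finiteness.\<close>

lemma order_metacyclic: "order (metacyclic n) = (nat (n^2))^2"
proof -
  let ?A = "{0..<n^2} \<times> {0..<n^2}"
  have "carrier (metacyclic n) = (\<lambda>(i, j). el n i j) ` ?A"
  proof
    show "carrier (metacyclic n) \<subseteq> (\<lambda>(i, j). el n i j) ` ?A"
    proof
      fix u assume "u \<in> carrier (metacyclic n)"
      then obtain i j where "u = el n i j" by (rule el_cases)
      then have "u = el n (i mod n^2) (j mod n^2)"
        by (simp add: el_def)
      moreover have "(i mod n^2, j mod n^2) \<in> ?A"
        using n_pos by simp
      ultimately show "u \<in> (\<lambda>(i, j). el n i j) ` ?A" by force
    qed
  qed auto
  moreover have "inj_on (\<lambda>(i, j). el n i j) ?A"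
    by (auto simp: inj_on_def el_eq_iff cong_def)
  ultimately have "card (carrier (metacyclic n)) = card ?A"
    by (simp add: card_image)
  then show ?thesis
    by (simp add: order_def power2_eq_square card_cartesian_product)
qed

lemma finite_metacyclic: "finite (carrier (metacyclic n))"
  using order_metacyclic n_pos by (intro card_ge_0_finite) (simp add: order_def)

section \<open>Generating sets\<close>

lemma generate_pow_el:
  assumes "el n i j \<in> generate (metacyclic n) S"
  shows "el n i j [^]\<^bsub>metacyclic n\<^esub> (t::nat) \<in> generate (metacyclic n) S"
  by (induction t) (auto simp del: pow_el mult_el intro: generate.one generate.eng assms)

text \<open>A unit modulo \<open>n\<close> is a unit modulo \<open>n^2\<close>. The multiplier is a
  natural number so that it can serve as an exponent of a power.\<close>

lemma coprime_multiple:
  assumes "coprime u n"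
  obtains t :: nat where "n^2 dvd int t * u - i"
proof -
  have "coprime u (n^2)"
    using assms by simp
  then obtain v where v: "[u * v = 1] (mod n^2)"
    using cong_solve_coprime_int by blast
  define t where "t = nat ((v * i) mod n^2)"
  have "int t = (v * i) mod n^2"
    using n_pos by (simp add: t_def)
  then have "[int t * u = v * i * u] (mod n^2)"
    by (simp add: cong_def mod_mult_left_eq)
  also have "v * i * u = u * v * i"
    by simp
  also have "[u * v * i = 1 * i] (mod n^2)"
    using v by (rule cong_scalar_right)
  finally show ?thesis
    using that by (simp add: cong_iff_dvd_diff)
qed

text \<open>A power of \<open>el n v w\<close> attains the desired exponent of \<open>b\<close>; a
  power of \<open>el n u 0\<close> on its left then corrects the exponent of \<open>a\<close>
  without a twist.\<close>

lemma generate_eq_carrier: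
  assumes S: "S \<subseteq> carrier (metacyclic n)"
    and u: "el n u 0 \<in> generate (metacyclic n) S" "coprime u n"
    and w: "el n v w \<in> generate (metacyclic n) S" "coprime w n"
  shows "generate (metacyclic n) S = carrier (metacyclic n)"
proof
  show "generate (metacyclic n) S \<subseteq> carrier (metacyclic n)"
    by (rule generate_incl[OF S])
  show "carrier (metacyclic n) \<subseteq> generate (metacyclic n) S"
  proof
    fix g assume "g \<in> carrier (metacyclic n)"
    then obtain i j where g: "g = el n i j" by (rule el_cases)
    obtain t where t: "n^2 dvd int t * w - j"
      by (rule coprime_multiple[OF w(2)])
    define k where "k = int t * v + n * int (t choose 2) * v * w"
    obtain s where s: "n^2 dvd int s * u - (i - k)"
      by (rule coprime_multiple[OF u(2)])
    have "g = el n u 0 [^]\<^bsub>metacyclic n\<^esub> s \<otimes>\<^bsub>metacyclic n\<^esub> el n v w [^]\<^bsub>metacyclic n\<^esub> t"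
      unfolding g pow_el mult_el k_def[symmetric]
      using s t by (intro el_eqI) (simp_all add: dvd_diff_commute algebra_simps)
    then show "g \<in> generate (metacyclic n) S"
      using generate_pow_el[OF u(1)] generate_pow_el[OF w(1)] by (metis generate.eng)
  qed
qed

section \<open>Conjugate powers and intersections of Sigma sets\<close>

text \<open>Twice the binomial coefficient is \<open>t*(t-1)\<close>, and 2 is a unit modulo odd
  \<open>n\<close>. Hence the correction term in \<open>pow_el\<close> vanishes modulo
  \<open>n^2\<close> at exponents divisible by \<open>n\<close>.\<close>

lemma dvd_choose_two:
  assumes "odd n" "n dvd int t"
  shows "n dvd int (t choose 2)"
proof -
  have "2 * int (t choose 2) = int t * (int t - 1)"
    by (induction t) (simp_all add: numeral_2_eq_2 algebra_simps)
  then have "n dvd 2 * int (t choose 2)"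
    using assms(2) by simp
  then show ?thesis
    using assms(1) by (simp add: coprime_dvd_mult_right_iff)
qed

text \<open>By Cramer's rule, \<open>s (a,b) \<equiv> t (c,d)\<close> modulo \<open>n\<close> gives \<open>n dvd s\<close> and \<open>n dvd t\<close>; then both powers
  are central, the congruence holds modulo \<open>n\<^sup>2\<close>, and Cramer's rule gives \<open>n\<^sup>2 dvd s\<close>.\<close>

lemma conjugate_pow_eq_imp_one:
  assumes n: "odd n" and det: "coprime (a * d - b * c) n"
    and g: "g \<in> carrier (metacyclic n)" and h: "h \<in> carrier (metacyclic n)"
    and eq: "conjugate (metacyclic n) (el n a b [^]\<^bsub>metacyclic n\<^esub> (s::nat)) g
           = conjugate (metacyclic n) (el n c d [^]\<^bsub>metacyclic n\<^esub> (t::nat)) h"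
  shows "conjugate (metacyclic n) (el n a b [^]\<^bsub>metacyclic n\<^esub> s) g = \<one>\<^bsub>metacyclic n\<^esub>"
proof -
  have solve: "m dvd int s \<and> m dvd int t"
    if "coprime (a * d - b * c) m" "m dvd int s * a - int t * c" "m dvd int s * b - int t * d" for m
  proof -
    have "int s * (a * d - b * c) = (int s * a - int t * c) * d - (int s * b - int t * d) * c"
      "int t * (a * d - b * c) = (int s * a - int t * c) * b - (int s * b - int t * d) * a"
      by (simp_all add: algebra_simps)
    then have "m dvd int s * (a * d - b * c)" "m dvd int t * (a * d - b * c)"
      using that(2,3) by (metis dvd_diff dvd_mult2)+
    then show ?thesis
      using that(1) by (metis coprime_commute coprime_dvd_mult_left_iff)
  qed
  obtain k l p q where gh: "g = el n k l" "h = el n p q"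
    using g h by (meson el_cases)
  \<comment> \<open>\<open>A\<close> and \<open>B\<close> collect the corrections that carry a
    factor \<open>n\<close>, both from taking the power and from conjugating.\<close>
  define A where "A = int (s choose 2) * a * b
    + (l * (int s * a + n * int (s choose 2) * a * b) - int s * b * k)"
  define B where "B = int (t choose 2) * c * d
    + (q * (int t * c + n * int (t choose 2) * c * d) - int t * d * p)"
  have A: "conjugate (metacyclic n) (el n a b [^]\<^bsub>metacyclic n\<^esub> s) g
      = el n (int s * a + n * A) (int s * b)"
    unfolding gh pow_el conjugate_el A_def by (simp add: algebra_simps)
  have B: "conjugate (metacyclic n) (el n c d [^]\<^bsub>metacyclic n\<^esub> t) h
      = el n (int t * c + n * B) (int t * d)"
    unfolding gh pow_el conjugate_el B_def by (simp add: algebra_simps)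
  from eq have E: "n^2 dvd int s * a + n * A - (int t * c + n * B)" "n^2 dvd int s * b - int t * d"
    unfolding A B by (rule el_eqD)+
  have "n dvd n^2"
    by (simp add: power2_eq_square)
  then have "n dvd int s * a + n * A - (int t * c + n * B)" "n dvd int s * b - int t * d"
    using E dvd_trans by blast+
  moreover have "int s * a + n * A - (int t * c + n * B) = int s * a - int t * c + n * (A - B)"
    by (simp add: algebra_simps)
  ultimately have "n dvd int s * a - int t * c" "n dvd int s * b - int t * d"
    by (simp_all add: dvd_add_left_iff)
  with det have st: "n dvd int s" "n dvd int t"
    using solve by blast+
  \<comment> \<open>Every term of \<open>A\<close> contains \<open>int s\<close> or
    \<open>s choose 2\<close>, and likewise for \<open>B\<close> and \<open>t\<close>.\<close>
  then have "n dvd A" "n dvd B"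
    using dvd_choose_two[OF n] unfolding A_def B_def by simp_all
  then have AB: "n^2 dvd n * A" "n^2 dvd n * B"
    by (simp_all add: power2_eq_square)
  have "int s * a - int t * c = (int s * a + n * A - (int t * c + n * B)) - n * A + n * B"
    by simp
  then have "n^2 dvd int s * a - int t * c"
    using E(1) AB by (metis dvd_add dvd_diff)
  then have "n^2 dvd int s"
    using solve[of "n^2"] E(2) det by simp
  then show ?thesis
    unfolding A one_metacyclic using AB by (intro el_eqI) simp_all
qed

lemma one_in_Sigma_set:
  assumes "x \<in> carrier (metacyclic n)"
  shows "\<one>\<^bsub>metacyclic n\<^esub> \<in> Sigma_set (metacyclic n) x y"
proof -
  \<comment> \<open>Exponents in \<open>Sigma_set\<close> start at 1, so the identity is obtained at
    the last one, the group order.\<close>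
  have "conjugate (metacyclic n) (x [^]\<^bsub>metacyclic n\<^esub> order (metacyclic n)) \<one>\<^bsub>metacyclic n\<^esub>
      = \<one>\<^bsub>metacyclic n\<^esub>"
    using assms by (simp add: pow_order_eq_1 conjugate_def)
  moreover have "order (metacyclic n) \<in> {1..order (metacyclic n)}"
    using n_pos by (simp add: order_metacyclic Suc_le_eq)
  ultimately show ?thesis
    unfolding Sigma_set_def using one_closed by (metis (no_types, lifting) UN_I insertI1)
qed

text \<open>A common element is a conjugate of a power of one entry from each triple, so nine unit
  determinants suffice. The third pair in each list holds the exponents of the product.\<close>

lemma Sigma_set_inter_el:
  assumes n: "odd n"
    and det: "\<And>a b c d. (a, b) \<in> {(a1, b1), (a2, b2), (a1 + a2 + n * b1 * a2, b1 + b2)} \<Longrightarrow>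
      (c, d) \<in> {(c1, d1), (c2, d2), (c1 + c2 + n * d1 * c2, d1 + d2)} \<Longrightarrow>
      coprime (a * d - b * c) n"
  shows "Sigma_set (metacyclic n) (el n a1 b1) (el n a2 b2)
       \<inter> Sigma_set (metacyclic n) (el n c1 d1) (el n c2 d2) = {\<one>\<^bsub>metacyclic n\<^esub>}"
proof -
  have Sigma: "\<exists>(a, b) \<in> {(a1, b1), (a2, b2), (a1 + a2 + n * b1 * a2, b1 + b2)}.
      \<exists>i::nat. \<exists>g \<in> carrier (metacyclic n).
        z = conjugate (metacyclic n) (el n a b [^]\<^bsub>metacyclic n\<^esub> i) g"
    if "z \<in> Sigma_set (metacyclic n) (el n a1 b1) (el n a2 b2)" for z a1 b1 a2 b2
    using that unfolding Sigma_set_def mult_el by blast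
  have "z = \<one>\<^bsub>metacyclic n\<^esub>"
    if z1: "z \<in> Sigma_set (metacyclic n) (el n a1 b1) (el n a2 b2)"
      and z2: "z \<in> Sigma_set (metacyclic n) (el n c1 d1) (el n c2 d2)" for z
  proof -
    obtain a b i g where 1: "(a, b) \<in> {(a1, b1), (a2, b2), (a1 + a2 + n * b1 * a2, b1 + b2)}"
        "g \<in> carrier (metacyclic n)"
        "z = conjugate (metacyclic n) (el n a b [^]\<^bsub>metacyclic n\<^esub> (i::nat)) g"
      using Sigma[OF z1] by blast
    obtain c d j h where 2: "(c, d) \<in> {(c1, d1), (c2, d2), (c1 + c2 + n * d1 * c2, d1 + d2)}"
        "h \<in> carrier (metacyclic n)"
        "z = conjugate (metacyclic n) (el n c d [^]\<^bsub>metacyclic n\<^esub> (j::nat)) h"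
      using Sigma[OF z2] by blast
    show ?thesis
      using conjugate_pow_eq_imp_one[OF n det[OF 1(1) 2(1)] 1(2) 2(2)] 1(3) 2(3) by metis
  qed
  then show ?thesis
    using one_in_Sigma_set by auto
qed

lemma coprime_add_multiple: "coprime c n \<Longrightarrow> coprime (c + n * k) n"
  by (metis coprime_iff_gcd_eq_1 gcd.commute gcd_add_mult mult.commute add.commute)

section \<open>The Beauville structure\<close>

lemma beauville_metacyclic:
  assumes "coprime n 6"
  shows "beauville_group (metacyclic n)"
proof -
  let ?x1 = "el n 1 0" and ?y1 = "el n 0 1" and ?x2 = "el n 1 2" and ?y2 = "el n 1 (-1)"
  have "coprime n (2 * 3)"
    using assms by simp
  then have cop: "coprime 2 n" "coprime 3 n" and "odd n"
    by (auto simp only: coprime_mult_right_iff coprime_commute coprime_right_2_iff_odd)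
  have "generate (metacyclic n) {?x1, ?y1} = carrier (metacyclic n)"
    by (rule generate_eq_carrier[of _ 1 0 1]) (auto intro: generate.incl)
  moreover have "generate (metacyclic n) {?x2, ?y2} = carrier (metacyclic n)"
  proof (rule generate_eq_carrier)
    \<comment> \<open>The exponents of \<open>b\<close> cancel as 2 - 1 - 1, leaving
      \<open>a^(3+3n)\<close>; here 3 must be a unit modulo \<open>n\<close>.\<close>
    have "?x2 \<otimes>\<^bsub>metacyclic n\<^esub> ?y2 \<otimes>\<^bsub>metacyclic n\<^esub> ?y2 \<in> generate (metacyclic n) {?x2, ?y2}"
      by (intro generate.eng) (simp_all add: generate.incl)
    then show "el n (3 + n * 3) 0 \<in> generate (metacyclic n) {?x2, ?y2}"
      by (simp add: algebra_simps)
    show "coprime (3 + n * 3) n"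
      by (rule coprime_add_multiple[OF cop(2)])
    show "?y2 \<in> generate (metacyclic n) {?x2, ?y2}"
      by (simp add: generate.incl)
  qed simp_all
  moreover have "Sigma_set (metacyclic n) ?x1 ?y1 \<inter> Sigma_set (metacyclic n) ?x2 ?y2
      = {\<one>\<^bsub>metacyclic n\<^esub>}"
  proof (rule Sigma_set_inter_el[OF \<open>odd n\<close>])
    fix a b c d :: int
    assume "(a, b) \<in> {(1, 0), (0, 1), (1 + 0 + n * 0 * 0, 0 + 1)}"
      and "(c, d) \<in> {(1, 2), (1, - 1), (1 + 1 + n * 2 * 1, 2 + - 1)}"
    \<comment> \<open>The nine determinants take these six values, each plus or minus 1 or 2 up to a
      multiple of \<open>n\<close>; the nonzero multiples come from the entry \<open>2 + 2*n\<close>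
      of the product \<open>?x2\<close>, \<open>?y2\<close>.\<close>
    then have "a * d - b * c
        \<in> {1 + n * 0, - 1 + n * 0, 2 + n * 0, - 2 + n * 0, - 1 + n * (- 2), - 2 + n * (- 2)}"
      by auto
    then show "coprime (a * d - b * c) n"
      by (elim insertE emptyE; elim ssubst; intro coprime_add_multiple) (use cop in simp_all)
  qed
  ultimately have "beauville_structure (metacyclic n) {(?x1, ?y1), (?x2, ?y2)}"
    unfolding beauville_structure_def using el_closed by blast
  then show ?thesis
    unfolding beauville_group_def using group_metacyclic finite_metacyclic by blast
qed

section \<open>Absence of strongly real structures\<close>

lemma no_hom_inverting_generators:
  assumes n: "n > 2" and \<psi>: "\<psi> \<in> hom (metacyclic n) (metacyclic n)"
    and gen: "generate (metacyclic n) S = carrier (metacyclic n)" and S: "S \<subseteq> carrier (metacyclic n)"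
    and inverts: "\<And>x. x \<in> S \<Longrightarrow> \<psi> x = inv\<^bsub>metacyclic n\<^esub> x"
  shows False
proof -
  interpret group_hom "metacyclic n" "metacyclic n" \<psi>
    by unfold_locales (rule \<psi>)
  \<comment> \<open>\<open>\<psi>\<close> acts as -1 modulo \<open>n\<close>. The induction provides
    some exponents for each element; \<open>minus\<close> below passes to prescribed ones, which
    agree with them modulo \<open>n^2\<close>.\<close>
  have gen_minus: "\<exists>i j k l. g = el n i j \<and> \<psi> g = el n k l \<and> n dvd i + k \<and> n dvd j + l"
    if "g \<in> generate (metacyclic n) S" for g
    using that
  proof induction
    case one
    have "\<psi> \<one>\<^bsub>metacyclic n\<^esub> = el n 0 0"
      by (simp add: one_metacyclic[symmetric])
    then show ?case
      using one_metacyclic by fastforce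
  next
    case (incl h)
    then obtain i j where "h = el n i j"
      using S by (meson el_cases subsetD)
    moreover from this have "\<psi> h = el n (n * j * i - i) (- j)"
      using inverts[OF incl] by simp
    ultimately show ?case
      by (intro exI[of _ i] exI[of _ j] exI[of _ "n * j * i - i"] exI[of _ "- j"]) simp
  next
    case (inv h)
    then obtain i j where h: "h = el n i j"
      using S by (meson el_cases subsetD)
    have "\<psi> (inv\<^bsub>metacyclic n\<^esub> h) = h"
      using inv S inverts by (simp add: subsetD)
    then show ?case
      unfolding h inv_el
      by (intro exI[of _ i] exI[of _ j] exI[of _ "n * j * i - i"] exI[of _ "- j"]) simp
  next
    case (eng g h)
    then obtain i j k l i' j' k' l' where
      g: "g = el n i j" "\<psi> g = el n k l" "n dvd i + k" "n dvd j + l" and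
      h: "h = el n i' j'" "\<psi> h = el n k' l'" "n dvd i' + k'" "n dvd j' + l'"
      by blast
    have "\<psi> (g \<otimes>\<^bsub>metacyclic n\<^esub> h) = el n (k + k' + n * l * k') (l + l')"
      using g(1,2) h(1,2) by (metis el_closed hom_mult mult_el)
    moreover have "g \<otimes>\<^bsub>metacyclic n\<^esub> h = el n (i + i' + n * j * i') (j + j')"
      by (simp add: g h)
    moreover have "n dvd (i + k) + (i' + k') + n * (j * i' + l * k')"
      "n dvd (j + l) + (j' + l')"
      using g h by (auto intro!: dvd_add)
    then have "n dvd (i + i' + n * j * i') + (k + k' + n * l * k')" "n dvd (j + j') + (l + l')"
      by (simp_all add: algebra_simps)
    ultimately show ?case by blast
  qed
  have minus: "\<exists>k l. \<psi> (el n i j) = el n k l \<and> n dvd i + k \<and> n dvd j + l" for i j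
  proof -
    obtain i' j' k l where *: "el n i j = el n i' j'" "\<psi> (el n i j) = el n k l"
        "n dvd i' + k" "n dvd j' + l"
      using gen el_closed gen_minus by metis
    have "n dvd i - i'" "n dvd j - j'"
      using el_eqD[OF *(1)] by (auto simp: power2_eq_square dest: dvd_mult_left)
    then have "n dvd i + k" "n dvd j + l"
      using dvd_add[OF _ *(3), of "i - i'"] dvd_add[OF _ *(4), of "j - j'"] by simp_all
    then show ?thesis
      using *(2) by blast
  qed
  obtain k l where a: "\<psi> (el n 1 0) = el n k l" "n dvd 1 + k" "n dvd 0 + l"
    using minus by blast
  obtain k' l' where b: "\<psi> (el n 0 1) = el n k' l'" "n dvd 0 + k'" "n dvd 1 + l'"
    using minus by blast
  have "\<psi> (el n n 0) = \<psi> (el n 1 0 [^]\<^bsub>metacyclic n\<^esub> nat n)"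
    using n by simp
  also have "\<dots> = el n k l [^]\<^bsub>metacyclic n\<^esub> nat n"
    by (simp only: hom_nat_pow el_closed a)
  also have "\<dots> = el n (- n) 0"
  proof -
    \<comment> \<open>These are the differences of the exponents of \<open>\<psi>(a)^n\<close> and
      \<open>a^(-n)\<close>; one factor \<open>n\<close> comes from the power, the other from
      \<open>k = -1\<close> and \<open>l = 0\<close> modulo \<open>n\<close>.\<close>
    have "n * n dvd n * (1 + k + int (nat n choose 2) * k * l)" "n * n dvd n * l"
      using a(2,3) by simp_all
    then show ?thesis
      unfolding pow_el using n_pos
      by (intro el_eqI) (simp_all add: power2_eq_square algebra_simps)
  qed
  finally have an: "\<psi> (el n n 0) = el n (- n) 0" .
  \<comment> \<open>The relation \<open>b a = a^n a b\<close>, to which \<open>\<psi>\<close> is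
    applied.\<close>
  have "el n 0 1 \<otimes>\<^bsub>metacyclic n\<^esub> el n 1 0
      = el n n 0 \<otimes>\<^bsub>metacyclic n\<^esub> (el n 1 0 \<otimes>\<^bsub>metacyclic n\<^esub> el n 0 1)"
    by (simp add: algebra_simps)
  then have "\<psi> (el n 0 1) \<otimes>\<^bsub>metacyclic n\<^esub> \<psi> (el n 1 0)
      = \<psi> (el n n 0) \<otimes>\<^bsub>metacyclic n\<^esub> (\<psi> (el n 1 0) \<otimes>\<^bsub>metacyclic n\<^esub> \<psi> (el n 0 1))"
    by (metis el_closed hom_mult m_closed)
  then have "el n (k' + k + n * l' * k) (l' + l) = el n (- n + (k + k' + n * l * k')) (l + l')"
    by (simp add: a b an)
  then have "n^2 dvd (k' + k + n * l' * k) - (- n + (k + k' + n * l * k'))"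
    by (rule el_eqD)
  then have "n * n dvd n * (l' * k + 1 - l * k')"
    by (simp add: power2_eq_square algebra_simps)
  then have "n dvd l' * k + 1 - l * k'"
    using n_pos by simp
  \<comment> \<open>Modulo \<open>n\<close>, \<open>k\<close> and \<open>l'\<close> are -1 and
    \<open>l\<close> is 0, so the previous expression is congruent to 2; this multiple of
    \<open>n\<close> is chosen so that the difference is exactly 2.\<close>
  moreover have "n dvd (1 + k) * l' - (1 + l') - l * k'"
    using a b by (intro dvd_diff) auto
  ultimately have "n dvd (l' * k + 1 - l * k') - ((1 + k) * l' - (1 + l') - l * k')"
    by (rule dvd_diff)
  also have "\<dots> = 2"
    by (simp add: algebra_simps)
  finally show False
    using n zdvd_imp_le by fastforce
qed

text \<open>Following \<open>\<phi>\<close> by conjugation with \<open>g\<close> gives an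
  endomorphism that inverts a generating pair.\<close>

lemma not_strongly_real_metacyclic:
  assumes n: "n > 2" and "beauville_structure (metacyclic n) S"
  shows "\<not> strongly_real (metacyclic n) S"
proof
  assume "strongly_real (metacyclic n) S"
  moreover obtain x y where xy: "(x, y) \<in> S" "x \<in> carrier (metacyclic n)" "y \<in> carrier (metacyclic n)"
      "generate (metacyclic n) {x, y} = carrier (metacyclic n)"
    using assms(2) unfolding beauville_structure_def by blast
  ultimately obtain \<phi> g where \<phi>: "\<phi> \<in> auto (metacyclic n)" and g: "g \<in> carrier (metacyclic n)"
    and inverts: "conjugate (metacyclic n) (\<phi> x) g = inv\<^bsub>metacyclic n\<^esub> x"
      "conjugate (metacyclic n) (\<phi> y) g = inv\<^bsub>metacyclic n\<^esub> y"
    unfolding strongly_real_def conjugate_def by blast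
  have hom: "\<phi> \<in> hom (metacyclic n) (metacyclic n)"
    using \<phi> by (simp add: auto_def)
  have "(\<lambda>u. conjugate (metacyclic n) (\<phi> u) g) \<in> hom (metacyclic n) (metacyclic n)"
  proof (rule homI)
    fix u v assume "u \<in> carrier (metacyclic n)" "v \<in> carrier (metacyclic n)"
    with hom have "\<phi> u \<in> carrier (metacyclic n)" "\<phi> v \<in> carrier (metacyclic n)"
      "\<phi> (u \<otimes>\<^bsub>metacyclic n\<^esub> v) = \<phi> u \<otimes>\<^bsub>metacyclic n\<^esub> \<phi> v"
      by (auto simp: hom_def)
    moreover have "inv\<^bsub>metacyclic n\<^esub> g \<otimes>\<^bsub>metacyclic n\<^esub> (g \<otimes>\<^bsub>metacyclic n\<^esub> w) = w"
      if "w \<in> carrier (metacyclic n)" for w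
      using g that by (simp flip: m_assoc)
    ultimately show "conjugate (metacyclic n) (\<phi> (u \<otimes>\<^bsub>metacyclic n\<^esub> v)) g
        = conjugate (metacyclic n) (\<phi> u) g \<otimes>\<^bsub>metacyclic n\<^esub> conjugate (metacyclic n) (\<phi> v) g"
      using g by (simp add: conjugate_def m_assoc)
  next
    fix u assume "u \<in> carrier (metacyclic n)"
    then show "conjugate (metacyclic n) (\<phi> u) g \<in> carrier (metacyclic n)"
      using hom g by (simp add: conjugate_def hom_in_carrier)
  qed
  then show False
    by (rule no_hom_inverting_generators[OF n _ xy(4)]) (use xy inverts in auto)
qed

lemma purely_non_strongly_real_metacyclic:
  assumes "coprime n 6" "n > 2"
  shows "purely_non_strongly_real_beauville_group (metacyclic n)"
  unfolding purely_non_strongly_real_beauville_group_def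
  using beauville_metacyclic not_strongly_real_metacyclic assms by blast

end

theorem corollary4p2:
  shows "\<exists>\<G> :: nat monoid set.
           infinite \<G> \<and>
           pairwise (\<lambda>G H. \<not> G \<cong> H) \<G> \<and>
           (\<forall>G\<in>\<G>. purely_non_strongly_real_beauville_group G)"
proof -
  \<comment> \<open>The numbers \<open>6*m + 5\<close> are coprime to 6 and exceed 2 already at
    \<open>m = 0\<close>. Since the order is the fourth power of this number, it determines
    \<open>m\<close>, which gives both infinitude and non-isomorphism.\<close>
  define G where "G m = metacyclic (6 * int m + 5)" for m
  have order_G: "order (G m) = ((6 * m + 5)\<^sup>2)\<^sup>2" for m
  proof -
    have "nat ((6 * int m + 5)\<^sup>2) = (6 * m + 5)\<^sup>2"
      by (simp add: nat_eq_iff)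
    then show ?thesis
      by (simp add: G_def order_metacyclic)
  qed
  have order_inj: "m = m'" if "order (G m) = order (G m')" for m m'
    using that unfolding order_G by (simp only: power2_eq_iff_nonneg zero_le)
  have "coprime (6 * int m + 5) 6" for m
  proof (rule coprimeI)
    fix d :: int assume "d dvd 6 * int m + 5" "d dvd 6"
    \<comment> \<open>The difference equals 1.\<close>
    then have "d dvd 6 * (int m + 1) - (6 * int m + 5)"
      by (intro dvd_diff dvd_mult2)
    then show "is_unit d" by simp
  qed
  then have "purely_non_strongly_real_beauville_group (G m)" for m
    unfolding G_def by (intro purely_non_strongly_real_metacyclic) simp_all
  moreover have "infinite (range G)"
    using order_inj by (intro range_inj_infinite injI) simp
  moreover have "pairwise (\<lambda>G H. \<not> G \<cong> H) (range G)"
    using order_inj iso_same_card unfolding pairwise_def order_def by blast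
  ultimately show ?thesis
    by blast
qed

end
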